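(* Let $X$ be a metric space. For each $n \in \mathbb{N} \cup \{\infty\}$, let $\mu_0^{(n)} \in \mathcal{P}(X)$ and let $\Phi^{(n)} \colon X \to \mathbb{R}$ be locally uniformly continuous. Suppose that, for each $n \in \mathbb{N} \cup \{\infty\}$, $Z^{(n)} := \int_X e^{-\Phi^{(n)}(x)}\, \mu_0^{(n)}(\mathrm{d}x) \in (0, \infty)$ and set $\mu^{(n)}(\mathrm{d}x) := \frac{1}{Z^{(n)}} e^{-\Phi^{(n)}(x)}\, \mu_0^{(n)}(\mathrm{d}x)$. Suppose that each $\mu_0^{(n)}$ has an Onsager--Machlup (OM) functional $I_0^{(n)} \colon E^{(n)} \to \mathbb{R}$. Then the following statements hold: (a) Each $\mu^{(n)}$ has $I^{(n)} := \Phi^{(n)} + I_0^{(n)} \colon E^{(n)} \to \mathbb{R}$ as an OM functional. (b) Suppose that property $M(\mu_0^{(n)}, E^{(n)})$ holds. Then property $M(\mu^{(n)}, E^{(n)})$ also holds, and the global weak modes of $\mu_0^{(n)}$ (resp. of $\mu^{(n)}$) are the global minimisers of the extended OM functional $I_0^{(n)} \colon X \to \overline{\mathbb{R}}$ (resp. of $I^{(n)} \colon X \to \overline{\mathbb{R}}$). (c) Suppose that $I_0^{(n)} \to I_0^{(\infty)}$ in the sense of $\Gamma$-convergence and $\Phi^{(n)} \to \Phi^{(\infty)}$ continuously as $n \to \infty$. Then the OM functionals $I^{(n)}$ satisfy $\Gamma\text{-}\lim_{n \to \infty} I^{(n)} = I^{(\infty)}$. (d) Suppose that the sequence $(I_0^{(n)})_{n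 \in \mathbb{N}}$ is equicoercive and the functions $\Phi^{(n)} \geq M$ are uniformly bounded from below by some constant $M \in \mathbb{R}$. Then the sequence $(I^{(n)})_{n \in \mathbb{N}}$ is also equicoercive with respect to the same representatives of $I^{(n)}$ as for the $\Gamma$-convergence. (e) Suppose that the assumptions of parts (b)--(d) all hold. Then the cluster points as $n \to \infty$ of the global weak modes of the posteriors $\mu^{(n)}$ are the global weak modes of the limiting posterior $\mu^{(\infty)}$.
   Context: For a metric space $X$, $\mathcal{P}(X)$ is the set of Borel probability measures on $X$, $B_r(x)$ is the open ball of radius $r$ centred at $x$, and $\overline{\mathbb{R}} = \mathbb{R} \cup \{\pm\infty\}$. The support of $\mu \in \mathcal{P}(X)$ is $\operatorname{supp}(\mu) = \{x \in X : \mu(B_r(x)) > 0 \text{ for all } r > 0\}$. The measures $\mu_0^{(n)}$ are thought of as priors and the measures $\mu^{(n)}$ as posteriors. Onsager--Machlup (OM) functional: for a nonempty set $E \subseteq \operatorname{supp}(\mu)$, a function $I \colon E \to \mathbb{R}$ is an OM functional for $\mu$ if $\lim_{r \searrow 0} \frac{\mu(B_r(x_1))}{\mu(B_r(x_2))} = \exp(I(x_2) - I(x_1))$ for all $x_1, x_2 \in E$. OM functionals are unique at best up to additive real constants; $\Gamma$-convergence and equicoercivity of a sequence of OM functionals mean that representatives (choices of these constants) with these properties exist, and where both properties are used the same representatives must serve for both. Property $M(\mu, E)$: there is some $x^\star \in E$ such that for every $x \in X \setminus E$, $\lim_{r \searrow 0} \frac{\mu(B_r(x))}{\mu(B_r(x^\star))}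 = 0$. Extended functionals: an OM functional on $E$ is extended to a function $X \to \overline{\mathbb{R}}$ by the value $+\infty$ on $X \setminus E$. In (b)--(e), $I_0^{(n)}$ and $I^{(n)}$ denote the functionals on $X$ so extended. Global weak mode of $\mu \in \mathcal{P}(X)$: a point $u \in \operatorname{supp}(\mu)$ such that for every $u' \in X$, $\limsup_{r \searrow 0} \frac{\mu(B_r(u'))}{\mu(B_r(u))} \leq 1$. Cluster points of the global weak modes of $\mu^{(n)}$ as $n \to \infty$: limits of convergent subsequences of sequences $(u^{(n)})_{n \in \mathbb{N}}$ in which each $u^{(n)}$ is a global weak mode of $\mu^{(n)}$. Locally uniformly continuous: $f \colon X \to Y$ between metric spaces is locally uniformly continuous if for every $x \in X$ there is a function $\omega_{f,x} \colon [0,\infty) \to [0,\infty]$ such that $d_Y(f(x'), f(x)) \leq \omega_{f,x}(d_X(x',x))$ for all $x' \in X$ and $\omega_{f,x}(r) \to 0$ as $r \to 0$; it is no loss of generality to assume that $\omega_{f,x}$ is increasing. $\Gamma$-convergence: functions $F_n \colon X \to \overline{\mathbb{R}}$ $\Gamma$-converge to $F \colon X \to \overline{\mathbb{R}}$, written $F = \Gamma\text{-}\lim_{n\to\infty} F_n$, if for every $x \in X$: (i) for every sequence $x_n \to x$, $F(x) \leq \liminf_{n \to \infty} F_n(x_n)$; and (ii) there exists a sequence $x_n \to x$ with $F(x) \geq \limsup_{n \to \infty} F_n(x_n)$. Continuous convergence: $F_n \to F$ continuously if for every $x \in X$ and every neighbourhood $V$ of $F(x)$ in $\overline{\mathbb{R}}$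 there exist $N \in \mathbb{N}$ and a neighbourhood $U$ of $x$ such that $F_n(x') \in V$ whenever $n \geq N$ and $x' \in U$. Equicoercivity: $(F_n)_{n \in \mathbb{N}}$ is equicoercive if for all $t \in \mathbb{R}$ there is a compact $K_t \subseteq X$ such that $F_n^{-1}([-\infty, t]) \subseteq K_t$ for all $n \in \mathbb{N}$.
   Formalization: In (e), "are the global weak modes" is read as inclusion: every cluster point is a global weak mode of the limiting posterior. The converse fails, e.g. on two points with zero potentials and priors slightly favouring one point, tending to uniform. *)

theory Defs
  imports "HOL-Probability.Probability" "HOL-Library.Extended_Nat"
begin

definition borel_prob :: "'a::metric_space measure set" where
  "borel_prob = {\<mu>. prob_space \<mu> \<and> sets \<mu> = sets borel}"

definition msupport :: "'a::metric_space measure \<Rightarrow> 'a set" where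
  "msupport \<mu> = {x. \<forall>r>0. measure \<mu> (ball x r) > 0}"

(* A functional E -> R is represented by a total function whose values off E are irrelevant. *)
definition OM_functional :: "'a::metric_space measure \<Rightarrow> 'a set \<Rightarrow> ('a \<Rightarrow> real) \<Rightarrow> bool" where
  "OM_functional \<mu> E I \<longleftrightarrow>
     E \<noteq> {} \<and> E \<subseteq> msupport \<mu> \<and>
     (\<forall>x1\<in>E. \<forall>x2\<in>E.
        ((\<lambda>r. measure \<mu> (ball x1 r) / measure \<mu> (ball x2 r)) \<longlongrightarrow> exp (I x2 - I x1)) (at_right 0))"

definition property_M :: "'a::metric_space measure \<Rightarrow> 'a set \<Rightarrow> bool" where
  "property_M \<mu> E \<longleftrightarrow>
     (\<exists>xstar\<in>E. \<forall>x. x \<notin> E \<longrightarrow>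
        ((\<lambda>r. measure \<mu> (ball x r) / measure \<mu> (ball xstar r)) \<longlongrightarrow> 0) (at_right 0))"

definition extend_inf :: "'a set \<Rightarrow> ('a \<Rightarrow> real) \<Rightarrow> 'a \<Rightarrow> ereal" where
  "extend_inf E f x = (if x \<in> E then ereal (f x) else \<infinity>)"

definition global_weak_mode :: "'a::metric_space measure \<Rightarrow> 'a \<Rightarrow> bool" where
  "global_weak_mode \<mu> u \<longleftrightarrow>
     u \<in> msupport \<mu> \<and>
     (\<forall>u'. Limsup (at_right 0) (\<lambda>r. ereal (measure \<mu> (ball u' r) / measure \<mu> (ball u r))) \<le> 1)"

definition global_minimiser :: "('a \<Rightarrow> ereal) \<Rightarrow> 'a \<Rightarrow> bool" where
  "global_minimiser F u \<longleftrightarrow> (\<forall>x. F u \<le> F x)"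

definition mode_cluster_points :: "(nat \<Rightarrow> 'a::metric_space measure) \<Rightarrow> 'a set" where
  "mode_cluster_points \<mu> =
     {x. \<exists>u s. (\<forall>n. global_weak_mode (\<mu> n) (u n)) \<and> strict_mono (s :: nat \<Rightarrow> nat) \<and>
               (\<lambda>k. u (s k)) \<longlonglongrightarrow> x}"

(* Only the values of the modulus on [0,\<infinity>) matter. *)
definition locally_uniformly_continuous ::
  "('a::metric_space \<Rightarrow> 'b::metric_space) \<Rightarrow> bool" where
  "locally_uniformly_continuous f \<longleftrightarrow>
     (\<forall>x. \<exists>\<omega> :: real \<Rightarrow> ennreal.
        (\<forall>x'. ennreal (dist (f x') (f x)) \<le> \<omega> (dist x' x)) \<and> (\<omega> \<longlongrightarrow> 0) (at_right 0))"

definition gamma_converges ::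
  "(nat \<Rightarrow> 'a::metric_space \<Rightarrow> ereal) \<Rightarrow> ('a \<Rightarrow> ereal) \<Rightarrow> bool" where
  "gamma_converges Fn F \<longleftrightarrow>
     (\<forall>x. (\<forall>xs. xs \<longlonglongrightarrow> x \<longrightarrow> F x \<le> liminf (\<lambda>n. Fn n (xs n))) \<and>
          (\<exists>xs. xs \<longlonglongrightarrow> x \<and> limsup (\<lambda>n. Fn n (xs n)) \<le> F x))"

definition continuously_converges ::
  "(nat \<Rightarrow> 'a::metric_space \<Rightarrow> ereal) \<Rightarrow> ('a \<Rightarrow> ereal) \<Rightarrow> bool" where
  "continuously_converges Fn F \<longleftrightarrow>
     (\<forall>x V. open V \<and> F x \<in> V \<longrightarrow>
        (\<exists>N U. open U \<and> x \<in> U \<and> (\<forall>n\<ge>N. \<forall>x'\<in>U. Fn n x' \<in> V)))"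

definition equicoercive :: "(nat \<Rightarrow> 'a::metric_space \<Rightarrow> ereal) \<Rightarrow> bool" where
  "equicoercive Fn \<longleftrightarrow>
     (\<forall>t::real. \<exists>K. compact K \<and> (\<forall>n. Fn n -` {..ereal t} \<subseteq> K))"

end

theory Submission
  imports Defs
begin

text \<open>
  Everything about the posterior follows from one local fact: if a density \<open>f\<close> is continuous at
  a point \<open>x\<close> of the support of \<open>M\<close>, then the mean of \<open>f\<close> over the balls around \<open>x\<close> tends to
  \<open>f x\<close> (\<open>density_ball_ratio_tendsto\<close>). A ratio of small-ball masses of the posterior is
  therefore asymptotically the same ratio for the prior, multiplied by
  \<open>f x / f y = exp (\<Phi> y - \<Phi> x)\<close>; the normalising constant cancels. This shifts an OM functional by
  \<open>\<Phi>\<close>, and it preserves null limits, hence property M (\<open>density_ratio_tendsto\<close>).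

  Property M says that the small-ball masses off \<open>E\<close> are negligible. Modes are then compared
  only with points of \<open>E\<close>, where the OM functional records every limiting ratio, so that the
  modes are the minimisers of the extended functional
  (\<open>global_weak_mode_iff_global_minimiser\<close>). This holds for prior and posterior alike.

  The statements on sequences concern functionals only. Under continuous convergence the
  numbers \<open>\<Phi> n (x n)\<close> converge to the real number \<open>\<Phi> \<infinity> x\<close> whenever \<open>x n\<close> converges to \<open>x\<close>, and a
  convergent real summand can be pulled out of a lower or upper limit. So both
  \<open>\<Gamma>\<close>-inequalities survive, with unchanged recovery sequences. A lower bound on the
  potentials puts each sublevel set of a posterior functional inside a sublevel set of the prior
  one, at a level independent of \<open>n\<close>, which gives equicoercivity. Finally, a limit of
  minimisers along a subsequence minimises the \<open>\<Gamma>\<close>-limit: the lower bound is applied to the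
  minimisers, the upper bound to a recovery sequence of any competitor.
\<close>

section \<open>Small balls under a density\<close>

lemma locally_uniformly_continuous_imp_isCont:
  fixes f :: "'a::metric_space \<Rightarrow> 'b::metric_space"
  assumes "locally_uniformly_continuous f"
  shows "isCont f x"
  unfolding continuous_at_eps_delta
proof (intro allI impI)
  fix e :: real assume e: "e > 0"
  obtain \<omega> :: "real \<Rightarrow> ennreal" where w: "\<And>x'. ennreal (dist (f x') (f x)) \<le> \<omega> (dist x' x)"
    and lim: "(\<omega> \<longlongrightarrow> 0) (at_right 0)"
    using assms unfolding locally_uniformly_continuous_def by blast
  have "eventually (\<lambda>r. \<omega> r < ennreal e) (at_right 0)"
    using order_tendstoD(2)[OF lim, of "ennreal e"] e by simp
  then obtain d where d: "d > 0" and small: "\<And>r. 0 < r \<Longrightarrow> r < d \<Longrightarrow> \<omega> r < ennreal e"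
    unfolding eventually_at_right_field by blast
  have "dist (f x') (f x) < e" if "dist x' x < d" for x'
  proof (cases "x' = x")
    case False
    have "ennreal (dist (f x') (f x)) < ennreal e"
      using w[of x'] small[of "dist x' x"] that False by (simp add: le_less_trans)
    then show ?thesis
      by (simp add: ennreal_less_iff)
  qed (use e in simp)
  then show "\<exists>d>0. \<forall>x'. dist x' x < d \<longrightarrow> dist (f x') (f x) < e"
    using d by blast
qed

text \<open>The mean of \<open>f\<close> over a small ball differs from \<open>f x\<close> by at most the oscillation of \<open>f\<close>
  there. Since \<open>x\<close> is in the support, these means are genuine, not quotients by 0.\<close>

lemma density_ball_ratio_tendsto:
  fixes f :: "'a::metric_space \<Rightarrow> real"
  assumes fin: "finite_measure M" and sets: "sets M = sets borel"
    and meas: "f \<in> borel_measurable borel" and nonneg: "\<And>y. 0 \<le> f y"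
    and cont: "isCont f x" and supp: "x \<in> msupport M"
  shows "((\<lambda>r. measure (density M f) (ball x r) / measure M (ball x r)) \<longlongrightarrow> f x) (at_right 0)"
proof (rule tendstoI)
  interpret finite_measure M by (rule fin)
  have [measurable]: "f \<in> borel_measurable M"
    using meas by (simp cong: measurable_cong_sets add: sets)
  fix e :: real assume "e > 0"
  then obtain h where h: "h > 0" "h < e"
    using dense by blast
  obtain d where d: "d > 0" and osc: "\<And>y. dist y x < d \<Longrightarrow> dist (f y) (f x) < h"
    using cont h unfolding continuous_at_eps_delta by blast
  have "dist (measure (density M f) (ball x r) / measure M (ball x r)) (f x) < e"
    if r: "0 < r" "r < d" for r
  proof -
    let ?B = "ball x r"
    have [measurable]: "?B \<in> sets M"
      by (simp add: sets)
    have near: "f x - h \<le> f y \<and> f y \<le> f x + h" if "y \<in> ?B" for y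
      using osc[of y] that r by (simp add: dist_commute dist_real_def abs_less_iff)
    have pos: "measure M ?B > 0"
      using supp r by (simp add: msupport_def)
    have eq: "emeasure (density M f) ?B = (\<integral>\<^sup>+ y. ennreal (f y) * indicator ?B y \<partial>M)"
      by (simp add: emeasure_density)
    have "emeasure (density M f) ?B \<le> (\<integral>\<^sup>+ y. ennreal (f x + h) * indicator ?B y \<partial>M)"
      unfolding eq using near by (intro nn_integral_mono) (auto split: split_indicator intro: ennreal_leI)
    also have "\<dots> = ennreal ((f x + h) * measure M ?B)"
      using nonneg[of x] h
      by (simp add: nn_integral_cmult_indicator emeasure_eq_measure ennreal_mult'')
    finally have upper: "emeasure (density M f) ?B \<le> ennreal ((f x + h) * measure M ?B)" .
    have "ennreal ((f x - h) * measure M ?B) = (\<integral>\<^sup>+ y. ennreal (f x - h) * indicator ?B y \<partial>M)"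
      by (simp add: nn_integral_cmult_indicator emeasure_eq_measure ennreal_mult'')
    also have "\<dots> \<le> emeasure (density M f) ?B"
      unfolding eq using near by (intro nn_integral_mono) (auto split: split_indicator intro: ennreal_leI)
    finally have lower: "ennreal ((f x - h) * measure M ?B) \<le> emeasure (density M f) ?B" .
    have real: "emeasure (density M f) ?B = ennreal (measure (density M f) ?B)"
      using upper by (intro emeasure_eq_ennreal_measure) (auto simp: top_unique)
    have "(f x - h) * measure M ?B \<le> measure (density M f) ?B"
      using lower by (simp add: real ennreal_le_iff)
    moreover have "measure (density M f) ?B \<le> (f x + h) * measure M ?B"
      using upper nonneg[of x] h pos by (simp add: real ennreal_le_iff)
    ultimately have "f x - h \<le> measure (density M f) ?B / measure M ?B"
      "measure (density M f) ?B / measure M ?B \<le> f x + h"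
      using pos by (simp_all add: field_simps)
    then show ?thesis
      using h by (simp add: dist_real_def abs_less_iff)
  qed
  then show "\<forall>\<^sub>F r in at_right 0.
      dist (measure (density M f) (ball x r) / measure M (ball x r)) (f x) < e"
    unfolding eventually_at_right_field using d by blast
qed

text \<open>The total mass must be finite because \<open>measure\<close> takes the default value 0 on sets of
  infinite mass, which would count such balls as null.\<close>

lemma msupport_subset_density:
  fixes f :: "'a::metric_space \<Rightarrow> real"
  assumes sets: "sets M = sets borel" and meas: "f \<in> borel_measurable borel"
    and pos: "\<And>y. 0 < f y" and fin: "finite_measure (density M f)"
  shows "msupport M \<subseteq> msupport (density M f)"
proof
  fix x assume x: "x \<in> msupport M"
  interpret D: finite_measure "density M f" by (rule fin)
  have [measurable]: "f \<in> borel_measurable M"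
    using meas by (simp cong: measurable_cong_sets add: sets)
  have "measure (density M f) (ball x r) > 0" if "r > 0" for r
  proof (rule ccontr)
    have [measurable]: "ball x r \<in> sets M"
      by (simp add: sets)
    assume "\<not> ?thesis"
    then have "emeasure (density M f) (ball x r) = 0"
      by (simp add: D.emeasure_eq_measure zero_less_measure_iff)
    then have "(\<integral>\<^sup>+ y. ennreal (f y) * indicator (ball x r) y \<partial>M) = 0"
      by (simp add: emeasure_density)
    then have "AE y in M. ennreal (f y) * indicator (ball x r) y = 0"
      by (subst (asm) nn_integral_0_iff_AE) auto
    moreover have "ennreal (f y) \<noteq> 0" for y
      using pos[of y] by (simp add: ennreal_eq_0_iff)
    ultimately have "AE y in M. y \<notin> ball x r"
      by (auto elim!: eventually_mono split: split_indicator_asm)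
    then have "emeasure M (ball x r) = 0"
      by (subst (asm) AE_iff_measurable[where N="ball x r"])
        (auto simp: sets sets_eq_imp_space_eq[OF sets])
    then have "measure M (ball x r) = 0"
      by (simp add: measure_def)
    then show False
      using x that by (force simp: msupport_def)
  qed
  then show "x \<in> msupport (density M f)"
    by (simp add: msupport_def)
qed

text \<open>The limit for \<open>M\<close> is multiplied by the limit of the two local means. If \<open>x\<close> lies off the
  support then small balls around \<open>x\<close> are null for both measures, so both limits are 0.\<close>

lemma density_ratio_tendsto:
  fixes f :: "'a::metric_space \<Rightarrow> real"
  assumes fin: "finite_measure M" and sets: "sets M = sets borel"
    and meas: "f \<in> borel_measurable borel" and pos: "\<And>z. 0 < f z"
    and cont: "\<And>z. isCont f z" and y: "y \<in> msupport M"
    and lim: "((\<lambda>r. measure M (ball x r) / measure M (ball y r)) \<longlongrightarrow> l) (at_right 0)"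
  shows "((\<lambda>r. measure (density M f) (ball x r) / measure (density M f) (ball y r))
           \<longlongrightarrow> f x / f y * l) (at_right 0)"
proof (cases "x \<in> msupport M")
  case True
  let ?q = "\<lambda>z r. measure (density M f) (ball z r) / measure M (ball z r)"
  have q: "(?q z \<longlongrightarrow> f z) (at_right 0)" if "z \<in> msupport M" for z
    using density_ball_ratio_tendsto[OF fin sets meas _ cont that] pos by (simp add: less_imp_le)
  have "((\<lambda>r. ?q x r / ?q y r * (measure M (ball x r) / measure M (ball y r)))
          \<longlongrightarrow> f x / f y * l) (at_right 0)"
    using pos[of y] by (intro tendsto_intros q True y lim) simp
  moreover have "\<forall>\<^sub>F r in at_right 0.
      ?q x r / ?q y r * (measure M (ball x r) / measure M (ball y r))
      = measure (density M f) (ball x r) / measure (density M f) (ball y r)"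
    using eventually_at_right_less
  proof eventually_elim
    case (elim r)
    then have "measure M (ball x r) > 0" "measure M (ball y r) > 0"
      using True y by (auto simp: msupport_def)
    then show ?case by simp
  qed
  ultimately show ?thesis
    by (rule Lim_transform_eventually)
next
  case False
  interpret finite_measure M by (rule fin)
  have [measurable]: "f \<in> borel_measurable M"
    using meas by (simp cong: measurable_cong_sets add: sets)
  obtain d where d: "d > 0" "measure M (ball x d) = 0"
    using False by (auto simp: msupport_def zero_less_measure_iff)
  have null: "\<forall>\<^sub>F r in at_right 0.
      measure M (ball x r) = 0 \<and> measure (density M f) (ball x r) = 0"
    unfolding eventually_at_right_field
  proof (intro exI[of _ d] conjI allI impI d(1))
    fix r :: real assume r: "r > 0" "r < d"
    have "measure M (ball x r) \<le> measure M (ball x d)"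
      using r by (intro finite_measure_mono) (auto simp: sets)
    then show 0: "measure M (ball x r) = 0"
      using d(2) measure_nonneg[of M "ball x r"] by linarith
    have "ball x r \<in> null_sets M"
      using 0 by (simp add: null_sets_def sets emeasure_eq_measure)
    then have "emeasure (density M f) (ball x r) = 0"
      by (simp add: emeasure_density sets nn_integral_null_set)
    then show "measure (density M f) (ball x r) = 0"
      by (simp add: measure_def)
  qed
  have "((\<lambda>r. measure M (ball x r) / measure M (ball y r)) \<longlongrightarrow> 0) (at_right 0)"
    by (rule tendsto_eventually) (use null in eventually_elim, simp)
  then have "l = 0"
    using tendsto_unique[OF _ lim] by simp
  moreover have "((\<lambda>r. measure (density M f) (ball x r) / measure (density M f) (ball y r))
      \<longlongrightarrow> 0) (at_right 0)"
    by (rule tendsto_eventually) (use null in eventually_elim, simp)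
  ultimately show ?thesis by simp
qed

section \<open>Modes and minimisers\<close>

text \<open>A mode must lie in \<open>E\<close>, since the point provided by property M beats every other point by an
  infinite factor. Conversely that point is comparable with every point of \<open>E\<close>, so a
  minimiser inherits its dominance over the points off \<open>E\<close>.\<close>

lemma global_weak_mode_iff_global_minimiser:
  assumes OM: "OM_functional \<mu> E I" and M: "property_M \<mu> E"
  shows "global_weak_mode \<mu> u \<longleftrightarrow> global_minimiser (extend_inf E I) u"
proof -
  let ?m = "\<lambda>z r. measure \<mu> (ball z r)"
  have ES: "E \<subseteq> msupport \<mu>"
    and lim: "\<And>x y. x \<in> E \<Longrightarrow> y \<in> E \<Longrightarrow> ((\<lambda>r. ?m x r / ?m y r) \<longlongrightarrow> exp (I y - I x)) (at_right 0)"
    using OM by (auto simp: OM_functional_def)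
  obtain s where s: "s \<in> E"
    and lim0: "\<And>x. x \<notin> E \<Longrightarrow> ((\<lambda>r. ?m x r / ?m s r) \<longlongrightarrow> 0) (at_right 0)"
    using M by (auto simp: property_M_def)
  have s_supp: "s \<in> msupport \<mu>"
    using s ES by blast
  have Limsup: "Limsup (at_right 0) (\<lambda>r. ereal (g r)) = ereal l"
    if "(g \<longlongrightarrow> l) (at_right 0)" for g :: "real \<Rightarrow> real" and l
    using that by (intro lim_imp_Limsup) auto
  have ev_pos: "\<forall>\<^sub>F r in at_right 0. ?m z r > 0" if "z \<in> msupport \<mu>" for z
    using eventually_at_right_less
    by eventually_elim (use that in \<open>simp add: msupport_def\<close>)
  show ?thesis
  proof
    assume mode: "global_weak_mode \<mu> u"
    have u: "u \<in> msupport \<mu>"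
      and le1: "\<And>x. Limsup (at_right 0) (\<lambda>r. ereal (?m x r / ?m u r)) \<le> 1"
      using mode by (auto simp: global_weak_mode_def)
    have uE: "u \<in> E"
    proof (rule ccontr)
      assume "u \<notin> E"
      then have "\<forall>\<^sub>F r in at_right 0. ?m u r / ?m s r < 1/2"
        by (intro order_tendstoD(2)[OF lim0]) auto
      then have "\<forall>\<^sub>F r in at_right 0. ereal 2 \<le> ereal (?m s r / ?m u r)"
        using ev_pos[OF u] ev_pos[OF s_supp]
        by eventually_elim (simp add: field_simps)
      then have "ereal 2 \<le> Limsup (at_right 0) (\<lambda>r. ereal (?m s r / ?m u r))"
        using le_Limsup[of "at_right (0::real)" "ereal 2"] by simp
      then have "ereal 2 \<le> 1"
        using le1[of s] order_trans by blast
      then show False by simp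
    qed
    have "I u \<le> I x" if "x \<in> E" for x
      using le1[of x] Limsup[OF lim[OF that uE]] by (simp add: one_ereal_def)
    then show "global_minimiser (extend_inf E I) u"
      using uE by (simp add: global_minimiser_def extend_inf_def)
  next
    assume min: "global_minimiser (extend_inf E I) u"
    have uE: "u \<in> E"
      using min[unfolded global_minimiser_def, rule_format, of s] s
      by (auto simp: extend_inf_def split: if_splits)
    have "Limsup (at_right 0) (\<lambda>r. ereal (?m x r / ?m u r)) \<le> 1" for x
    proof (cases "x \<in> E")
      case True
      have "I u \<le> I x"
        using min[unfolded global_minimiser_def, rule_format, of x] uE True
        by (simp add: extend_inf_def)
      then show ?thesis
        using Limsup[OF lim[OF True uE]] by (simp add: one_ereal_def)
    next
      case False
      have "((\<lambda>r. ?m x r / ?m s r * (?m s r / ?m u r)) \<longlongrightarrow> 0 * exp (I u - I s)) (at_right 0)"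
        by (intro tendsto_mult lim0[OF False] lim[OF s uE])
      moreover have "\<forall>\<^sub>F r in at_right 0. ?m x r / ?m s r * (?m s r / ?m u r) = ?m x r / ?m u r"
        using ev_pos[OF s_supp] by eventually_elim simp
      ultimately have "((\<lambda>r. ?m x r / ?m u r) \<longlongrightarrow> 0 * exp (I u - I s)) (at_right 0)"
        by (rule Lim_transform_eventually)
      then have "((\<lambda>r. ?m x r / ?m u r) \<longlongrightarrow> 0) (at_right 0)"
        by simp
      from Limsup[OF this] show ?thesis
        by simp
    qed
    then show "global_weak_mode \<mu> u"
      using uE ES by (auto simp: global_weak_mode_def)
  qed
qed

section \<open>Continuous perturbations and \<open>\<Gamma>\<close>-limits\<close>

lemma continuously_converges_tendsto:
  assumes "continuously_converges Fn F" "xs \<longlonglongrightarrow> x"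
  shows "(\<lambda>n. Fn n (xs n)) \<longlonglongrightarrow> F x"
proof (rule topological_tendstoI)
  fix V assume "open V" "F x \<in> V"
  then obtain N U where U: "open U" "x \<in> U" and NU: "\<forall>n\<ge>N. \<forall>x'\<in>U. Fn n x' \<in> V"
    using assms(1)[unfolded continuously_converges_def, rule_format, of V x] by auto
  have "\<forall>\<^sub>F n in sequentially. xs n \<in> U"
    using assms(2) U by (rule topological_tendstoD)
  with eventually_ge_at_top[of N] show "\<forall>\<^sub>F n in sequentially. Fn n (xs n) \<in> V"
    by eventually_elim (use NU in blast)
qed

text \<open>The perturbation has a real limit, hence no undefined sum \<open>\<infinity> - \<infinity>\<close> arises and the limit can
  be taken out of both the lower and the upper limit.\<close>

lemma gamma_converges_add_continuous:
  fixes p :: "nat \<Rightarrow> 'a::metric_space \<Rightarrow> real" and q :: "'a \<Rightarrow> real"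
  assumes G: "gamma_converges Fn F"
    and C: "continuously_converges (\<lambda>n x. ereal (p n x)) (\<lambda>x. ereal (q x))"
  shows "gamma_converges (\<lambda>n x. ereal (p n x) + Fn n x) (\<lambda>x. ereal (q x) + F x)"
  unfolding gamma_converges_def
proof (intro allI conjI impI)
  fix x and xs :: "nat \<Rightarrow> 'a" assume "xs \<longlonglongrightarrow> x"
  then have "liminf (\<lambda>n. ereal (p n (xs n)) + Fn n (xs n)) = ereal (q x) + liminf (\<lambda>n. Fn n (xs n))"
    using continuously_converges_tendsto[OF C] by (intro ereal_liminf_lim_add) auto
  then show "ereal (q x) + F x \<le> liminf (\<lambda>n. ereal (p n (xs n)) + Fn n (xs n))"
    using G \<open>xs \<longlonglongrightarrow> x\<close> by (simp add: gamma_converges_def add_left_mono)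
next
  fix x
  obtain xs where xs: "xs \<longlonglongrightarrow> x" "limsup (\<lambda>n. Fn n (xs n)) \<le> F x"
    using G unfolding gamma_converges_def by blast
  have "limsup (\<lambda>n. ereal (p n (xs n)) + Fn n (xs n)) = ereal (q x) + limsup (\<lambda>n. Fn n (xs n))"
    using continuously_converges_tendsto[OF C xs(1)] by (intro ereal_limsup_lim_add) auto
  then show "\<exists>xs. xs \<longlonglongrightarrow> x \<and> limsup (\<lambda>n. ereal (p n (xs n)) + Fn n (xs n)) \<le> ereal (q x) + F x"
    using xs by (auto simp: add_left_mono)
qed

lemma equicoercive_add_bounded_below:
  fixes p :: "nat \<Rightarrow> 'a::metric_space \<Rightarrow> real"
  assumes "equicoercive Fn" and bound: "\<And>n x. B \<le> p n x"
  shows "equicoercive (\<lambda>n x. ereal (p n x) + Fn n x)"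
  unfolding equicoercive_def
proof
  fix t :: real
  obtain K where K: "compact K" "\<And>n. Fn n -` {..ereal (t - B)} \<subseteq> K"
    using assms(1) unfolding equicoercive_def by blast
  have "Fn n x \<le> ereal (t - B)" if "ereal (p n x) + Fn n x \<le> ereal t" for n x
    using that bound[of n x] by (cases "Fn n x") auto
  then have "(\<lambda>x. ereal (p n x) + Fn n x) -` {..ereal t} \<subseteq> Fn n -` {..ereal (t - B)}" for n
    by auto
  then show "\<exists>K. compact K \<and> (\<forall>n. (\<lambda>x. ereal (p n x) + Fn n x) -` {..ereal t} \<subseteq> K)"
    using K by (meson order_trans)
qed

text \<open>At the indices of the subsequence the minimisers do no worse than a recovery sequence of any
  competitor \<open>y\<close>, which bounds \<open>F x\<close> by \<open>F y\<close>.\<close>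

lemma gamma_converges_limit_of_minimisers:
  fixes Fn :: "nat \<Rightarrow> 'a::metric_space \<Rightarrow> ereal"
  assumes G: "gamma_converges Fn F" and min: "\<And>n. global_minimiser (Fn n) (u n)"
    and s: "strict_mono s" and lim: "(\<lambda>k. u (s k)) \<longlonglongrightarrow> x"
  shows "global_minimiser F x"
  unfolding global_minimiser_def
proof
  fix y
  obtain ys where ys: "ys \<longlonglongrightarrow> y" "limsup (\<lambda>n. Fn n (ys n)) \<le> F y"
    using G unfolding gamma_converges_def by blast
  \<comment> \<open>The lower bound speaks of full sequences, so the gaps of the subsequence are filled with
    the limit point itself.\<close>
  define xs where "xs n = (if n \<in> range s then u n else x)" for n
  have "xs \<longlonglongrightarrow> x"
    unfolding tendsto_iff
  proof (intro allI impI)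
    fix e :: real assume e: "e > 0"
    obtain K where K: "\<And>k. k \<ge> K \<Longrightarrow> dist (u (s k)) x < e"
      using tendstoD[OF lim e] unfolding eventually_sequentially by blast
    have "dist (xs n) x < e" if "n \<ge> s K" for n
      using that K e strict_mono_less_eq[OF s] by (auto simp: xs_def)
    then show "\<forall>\<^sub>F n in sequentially. dist (xs n) x < e"
      unfolding eventually_sequentially by blast
  qed
  then have "F x \<le> liminf (\<lambda>n. Fn n (xs n))"
    using G unfolding gamma_converges_def by blast
  also have "\<dots> \<le> liminf ((\<lambda>n. Fn n (xs n)) \<circ> s)"
    by (rule liminf_subseq_mono[OF s])
  also have "\<dots> \<le> liminf ((\<lambda>n. Fn n (ys n)) \<circ> s)"
    using min by (intro Liminf_mono) (auto simp: xs_def global_minimiser_def)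
  also have "\<dots> \<le> limsup ((\<lambda>n. Fn n (ys n)) \<circ> s)"
    by (rule Liminf_le_Limsup) simp
  also have "\<dots> \<le> limsup (\<lambda>n. Fn n (ys n))"
    by (rule limsup_subseq_mono[OF s])
  also have "\<dots> \<le> F y"
    by (rule ys(2))
  finally show "F x \<le> F y" .
qed

lemma extend_inf_add: "extend_inf E (\<lambda>x. g x + f x) = (\<lambda>x. ereal (g x) + extend_inf E f x)"
  by (auto simp: extend_inf_def)

text \<open>Minimisers do not see the choice of representative of an OM functional, so the constants
  chosen for \<open>\<Gamma>\<close>-convergence do not affect the modes.\<close>

lemma global_minimiser_extend_inf_add_const:
  "global_minimiser (extend_inf E (\<lambda>x. f x + c)) u \<longleftrightarrow> global_minimiser (extend_inf E f) u"
  by (auto simp: global_minimiser_def extend_inf_def)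

section \<open>Transfer from priors to posteriors\<close>

theorem theorem6p1:
  fixes \<mu>0 \<mu> :: "enat \<Rightarrow> 'a::metric_space measure"
    and \<Phi> I0 I :: "enat \<Rightarrow> 'a \<Rightarrow> real"
    and Z :: "enat \<Rightarrow> ennreal"
    and E :: "enat \<Rightarrow> 'a set"
  assumes prior: "\<And>n. \<mu>0 n \<in> borel_prob"
    and potential: "\<And>n. locally_uniformly_continuous (\<Phi> n)"
    and Z_def: "\<And>n. Z n = (\<integral>\<^sup>+ x. ennreal (exp (- \<Phi> n x)) \<partial>\<mu>0 n)"
    and Z_range: "\<And>n. 0 < Z n \<and> Z n < \<infinity>"
    and posterior: "\<And>n. \<mu> n = density (\<mu>0 n) (\<lambda>x. 1 / Z n * ennreal (exp (- \<Phi> n x)))"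
    and OM_prior: "\<And>n. OM_functional (\<mu>0 n) (E n) (I0 n)"
    and I_def: "\<And>n x. I n x = \<Phi> n x + I0 n x"
  shows
    "(\<forall>n. OM_functional (\<mu> n) (E n) (I n))
     \<and>
     (\<forall>n. property_M (\<mu>0 n) (E n) \<longrightarrow>
        property_M (\<mu> n) (E n) \<and>
        {u. global_weak_mode (\<mu>0 n) u} = {u. global_minimiser (extend_inf (E n) (I0 n)) u} \<and>
        {u. global_weak_mode (\<mu> n) u} = {u. global_minimiser (extend_inf (E n) (I n)) u})
     \<and>
     (\<forall>c :: enat \<Rightarrow> real.
        gamma_converges (\<lambda>n. extend_inf (E (enat n)) (\<lambda>x. I0 (enat n) x + c (enat n)))
                        (extend_inf (E \<infinity>) (\<lambda>x. I0 \<infinity> x + c \<infinity>)) \<and>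
        continuously_converges (\<lambda>n x. ereal (\<Phi> (enat n) x)) (\<lambda>x. ereal (\<Phi> \<infinity> x)) \<longrightarrow>
        gamma_converges (\<lambda>n. extend_inf (E (enat n)) (\<lambda>x. I (enat n) x + c (enat n)))
                        (extend_inf (E \<infinity>) (\<lambda>x. I \<infinity> x + c \<infinity>)))
     \<and>
     (\<forall>c :: enat \<Rightarrow> real.
        equicoercive (\<lambda>n. extend_inf (E (enat n)) (\<lambda>x. I0 (enat n) x + c (enat n))) \<and>
        (\<exists>M. \<forall>n x. M \<le> \<Phi> (enat n) x) \<longrightarrow>
        equicoercive (\<lambda>n. extend_inf (E (enat n)) (\<lambda>x. I (enat n) x + c (enat n))))
     \<and>
     ((\<forall>n. property_M (\<mu>0 n) (E n)) \<and>
      (\<exists>c :: enat \<Rightarrow> real.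
        gamma_converges (\<lambda>n. extend_inf (E (enat n)) (\<lambda>x. I0 (enat n) x + c (enat n)))
                        (extend_inf (E \<infinity>) (\<lambda>x. I0 \<infinity> x + c \<infinity>)) \<and>
        equicoercive (\<lambda>n. extend_inf (E (enat n)) (\<lambda>x. I0 (enat n) x + c (enat n)))) \<and>
      continuously_converges (\<lambda>n x. ereal (\<Phi> (enat n) x)) (\<lambda>x. ereal (\<Phi> \<infinity> x)) \<and>
      (\<exists>M. \<forall>n x. M \<le> \<Phi> (enat n) x) \<longrightarrow>
        mode_cluster_points (\<lambda>n. \<mu> (enat n)) \<subseteq> {u. global_weak_mode (\<mu> \<infinity>) u})"
proof -
  let ?prior = "\<lambda>c n. extend_inf (E n) (\<lambda>x. I0 n x + c n)"
  let ?post = "\<lambda>c n. extend_inf (E n) (\<lambda>x. I n x + c n)"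
  let ?Phi_conv = "continuously_converges (\<lambda>n x. ereal (\<Phi> (enat n) x)) (\<lambda>x. ereal (\<Phi> \<infinity> x))"
  let ?Phi_bound = "\<exists>B. \<forall>n x. B \<le> \<Phi> (enat n) x"
  have cont: "isCont (\<Phi> n) x" for n x
    using potential by (rule locally_uniformly_continuous_imp_isCont)
  then have Phi_meas [measurable]: "\<Phi> n \<in> borel_measurable borel" for n
    by (intro borel_measurable_continuous_onI continuous_at_imp_continuous_on) auto
  have sets0: "sets (\<mu>0 n) = sets borel" and prob0: "prob_space (\<mu>0 n)" for n
    using prior[of n] by (auto simp: borel_prob_def)
  define f where "f n x = exp (- \<Phi> n x) / enn2real (Z n)" for n x
  have z: "enn2real (Z n) > 0" "Z n = ennreal (enn2real (Z n))" for n
    using Z_range[of n] by (auto simp: enn2real_positive_iff)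
  have f_pos: "f n x > 0" for n x
    using z by (simp add: f_def)
  have f_cont: "isCont (f n) x" for n x
    unfolding f_def using z(1)[of n] cont by (intro continuous_intros) auto
  have f_meas [measurable]: "f n \<in> borel_measurable borel" for n
    unfolding f_def by measurable
  have f_eq: "1 / Z n * ennreal (exp (- \<Phi> n x)) = ennreal (f n x)" for n x
  proof -
    have "1 / Z n = ennreal (1 / enn2real (Z n))"
      using z[of n] divide_ennreal[of 1 "enn2real (Z n)"] by simp
    then show ?thesis
      using z(1)[of n] by (simp add: f_def ennreal_mult[symmetric])
  qed
  have mu: "\<mu> n = density (\<mu>0 n) (f n)" for n
    by (simp add: posterior f_eq)
  have fin0: "finite_measure (\<mu>0 n)" for n
    using prob0 by (rule prob_space.finite_measure)
  have fin: "finite_measure (density (\<mu>0 n) (f n))" for n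
  proof
    have [measurable]: "\<Phi> n \<in> borel_measurable (\<mu>0 n)"
      using Phi_meas by (simp cong: measurable_cong_sets add: sets0)
    have "emeasure (\<mu> n) (space (\<mu> n)) = (\<integral>\<^sup>+ x. 1 / Z n * ennreal (exp (- \<Phi> n x)) \<partial>\<mu>0 n)"
      unfolding posterior by (simp add: emeasure_density cong: nn_integral_cong)
    also have "\<dots> = 1 / Z n * Z n"
      by (simp add: nn_integral_cmult Z_def)
    also have "\<dots> \<noteq> \<infinity>"
      using Z_range[of n] by (simp add: ennreal_mult_eq_top_iff ennreal_divide_eq_top_iff)
    finally show "emeasure (density (\<mu>0 n) (f n)) (space (density (\<mu>0 n) (f n))) \<noteq> \<infinity>"
      by (simp add: mu)
  qed
  have E_ne: "E n \<noteq> {}" and E_supp: "E n \<subseteq> msupport (\<mu>0 n)" for n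
    using OM_prior[of n] by (auto simp: OM_functional_def)
  have ratio: "((\<lambda>r. measure (\<mu> n) (ball x r) / measure (\<mu> n) (ball y r))
      \<longlongrightarrow> f n x / f n y * l) (at_right 0)"
    if "y \<in> E n"
      and "((\<lambda>r. measure (\<mu>0 n) (ball x r) / measure (\<mu>0 n) (ball y r)) \<longlongrightarrow> l) (at_right 0)"
    for n x y l
    unfolding mu
    by (rule density_ratio_tendsto[OF fin0 sets0 f_meas f_pos f_cont subsetD[OF E_supp that(1)] that(2)])
  have OM: "OM_functional (\<mu> n) (E n) (I n)" for n
    unfolding OM_functional_def
  proof (intro conjI ballI E_ne)
    show "E n \<subseteq> msupport (\<mu> n)"
      using E_supp[of n] msupport_subset_density[OF sets0 f_meas f_pos fin] by (force simp: mu)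
    fix x y assume xy: "x \<in> E n" "y \<in> E n"
    have "((\<lambda>r. measure (\<mu>0 n) (ball x r) / measure (\<mu>0 n) (ball y r))
        \<longlongrightarrow> exp (I0 n y - I0 n x)) (at_right 0)"
      using OM_prior[of n] xy by (simp add: OM_functional_def)
    from ratio[OF xy(2) this]
    have "((\<lambda>r. measure (\<mu> n) (ball x r) / measure (\<mu> n) (ball y r))
        \<longlongrightarrow> f n x / f n y * exp (I0 n y - I0 n x)) (at_right 0)" .
    moreover have "f n x / f n y * exp (I0 n y - I0 n x) = exp (I n y - I n x)"
      using z(1)[of n] by (simp add: f_def I_def exp_diff exp_add exp_minus field_simps)
    ultimately show "((\<lambda>r. measure (\<mu> n) (ball x r) / measure (\<mu> n) (ball y r))
        \<longlongrightarrow> exp (I n y - I n x)) (at_right 0)"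
      by simp
  qed
  have M: "property_M (\<mu> n) (E n)" if prior_M: "property_M (\<mu>0 n) (E n)" for n
  proof -
    obtain s where s: "s \<in> E n" and lim: "\<And>x. x \<notin> E n \<Longrightarrow>
        ((\<lambda>r. measure (\<mu>0 n) (ball x r) / measure (\<mu>0 n) (ball s r)) \<longlongrightarrow> 0) (at_right 0)"
      using prior_M unfolding property_M_def by blast
    show ?thesis
      unfolding property_M_def using s ratio[OF s lim] by auto
  qed
  have modes0: "{u. global_weak_mode (\<mu>0 n) u} = {u. global_minimiser (extend_inf (E n) (I0 n)) u}"
    if "property_M (\<mu>0 n) (E n)" for n
    using global_weak_mode_iff_global_minimiser[OF OM_prior that] by simp
  have modes: "{u. global_weak_mode (\<mu> n) u} = {u. global_minimiser (extend_inf (E n) (I n)) u}"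
    if "property_M (\<mu>0 n) (E n)" for n
    using global_weak_mode_iff_global_minimiser[OF OM M[OF that]] by simp
  have split: "?post c n = (\<lambda>x. ereal (\<Phi> n x) + ?prior c n x)" for c n
    unfolding I_def add.assoc by (rule extend_inf_add)
  have gamma: "gamma_converges (\<lambda>n. ?post c (enat n)) (?post c \<infinity>)"
    if "gamma_converges (\<lambda>n. ?prior c (enat n)) (?prior c \<infinity>)"
      ?Phi_conv for c
    unfolding split using that by (rule gamma_converges_add_continuous)
  have coercive: "equicoercive (\<lambda>n. ?post c (enat n))"
    if "equicoercive (\<lambda>n. ?prior c (enat n))" ?Phi_bound for c
    unfolding split using that(2) by (elim exE, intro equicoercive_add_bounded_below that(1)) blast
  have cluster: "mode_cluster_points (\<lambda>n. \<mu> (enat n)) \<subseteq> {u. global_weak_mode (\<mu> \<infinity>) u}"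
    if all_M: "\<forall>n. property_M (\<mu>0 n) (E n)"
      and G: "gamma_converges (\<lambda>n. ?post c (enat n)) (?post c \<infinity>)" for c
  proof
    have mode_iff: "global_weak_mode (\<mu> n) u \<longleftrightarrow> global_minimiser (?post c n) u" for n u
      unfolding global_minimiser_extend_inf_add_const
      using modes[OF all_M[rule_format], of n] by (simp add: set_eq_iff)
    fix x assume "x \<in> mode_cluster_points (\<lambda>n. \<mu> (enat n))"
    then obtain u s where "\<And>n. global_weak_mode (\<mu> (enat n)) (u n)" "strict_mono s"
      "(\<lambda>k. u (s k)) \<longlonglongrightarrow> x"
      by (auto simp: mode_cluster_points_def)
    then have "global_minimiser (?post c \<infinity>) x"
      by (intro gamma_converges_limit_of_minimisers[OF G, of u s]) (auto simp: mode_iff)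
    then show "x \<in> {u. global_weak_mode (\<mu> \<infinity>) u}"
      by (simp add: mode_iff)
  qed
  show ?thesis
  proof (intro conjI)
    show "\<forall>n. OM_functional (\<mu> n) (E n) (I n)"
      using OM by blast
  next
    show "\<forall>n. property_M (\<mu>0 n) (E n) \<longrightarrow>
        property_M (\<mu> n) (E n) \<and>
        {u. global_weak_mode (\<mu>0 n) u} = {u. global_minimiser (extend_inf (E n) (I0 n)) u} \<and>
        {u. global_weak_mode (\<mu> n) u} = {u. global_minimiser (extend_inf (E n) (I n)) u}"
      using M modes0 modes by blast
  next
    show "\<forall>c. gamma_converges (\<lambda>n. ?prior c (enat n)) (?prior c \<infinity>) \<and> ?Phi_conv \<longrightarrow>
        gamma_converges (\<lambda>n. ?post c (enat n)) (?post c \<infinity>)"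
      by (intro allI impI, elim conjE) (rule gamma)
  next
    show "\<forall>c. equicoercive (\<lambda>n. ?prior c (enat n)) \<and> ?Phi_bound \<longrightarrow>
        equicoercive (\<lambda>n. ?post c (enat n))"
      by (intro allI impI, elim conjE) (rule coercive)
  next
    show "(\<forall>n. property_M (\<mu>0 n) (E n)) \<and>
        (\<exists>c. gamma_converges (\<lambda>n. ?prior c (enat n)) (?prior c \<infinity>) \<and>
             equicoercive (\<lambda>n. ?prior c (enat n))) \<and> ?Phi_conv \<and> ?Phi_bound \<longrightarrow>
        mode_cluster_points (\<lambda>n. \<mu> (enat n)) \<subseteq> {u. global_weak_mode (\<mu> \<infinity>) u}"
    proof (rule impI, elim conjE exE)
      fix c
      assume "\<forall>n. property_M (\<mu>0 n) (E n)" "gamma_converges (\<lambda>n. ?prior c (enat n)) (?prior c \<infinity>)"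
        ?Phi_conv
      then show "mode_cluster_points (\<lambda>n. \<mu> (enat n)) \<subseteq> {u. global_weak_mode (\<mu> \<infinity>) u}"
        by (intro cluster gamma)
    qed
  qed
qed

end
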